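(* Let $R$ be a commutative ring with identity and let $S$ be a multiplicative subset of $R$. The following assertions are equivalent: 1. $R$ is c-$S$-coherent. 2. Every finitely generated ideal of $R$ is c-$S$-finitely presented. 3. For every finitely generated ideal $I$ of $R$, there is a finitely presented ideal $J\subseteq I$ such that $I_S=J_S$. In particular, when assertion 3 holds, $R_S$ is a coherent ring.
   Context: All rings are commutative with identity and all modules are unitary. A multiplicative subset of $R$ is a subset containing $1$ and closed under multiplication. $R_S$ is the localization of $R$ at $S$, and for an ideal $I$, $I_S$ is its localization, viewed as an ideal of $R_S$. An $R$-module $M$ is $S$-finite if there exist a finitely generated submodule $N$ of $M$ and $s\in S$ such that $sM\subseteq N$. An $R$-module $M$ is c-$S$-finitely presented if there exist a finitely presented submodule $N$ of $M$ and $s\in S$ such that $sM\subseteq N\subseteq M$. The ring $R$ is c-$S$-coherent if every $S$-finite ideal of $R$ is c-$S$-finitely presented. A ring is coherent if each of its finitely generated ideals is finitely presented. *)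

theory Defs
  imports "HOL-Algebra.Algebra"
begin
text \<open>A submodule \<open>N\<close> of \<open>M\<close>, regarded as a module in its own right, is written
  \<open>M\<lparr>carrier := N\<rparr>\<close>, as in the library lemma \<open>submodule.submodule_is_module\<close>.\<close>

definition gen_submodule :: "('a, 'b) ring_scheme \<Rightarrow> ('a, 'c, 'd) module_scheme \<Rightarrow> 'c set \<Rightarrow> 'c set"
  where "gen_submodule R M A = \<Inter>{N. submodule N R M \<and> A \<subseteq> N}"

definition fin_gen_module :: "('a, 'b) ring_scheme \<Rightarrow> ('a, 'c, 'd) module_scheme \<Rightarrow> bool"
  where "fin_gen_module R M \<longleftrightarrow>
    (\<exists>A. finite A \<and> A \<subseteq> carrier M \<and> carrier M = gen_submodule R M A)"

definition lin_maps ::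
  "('a, 'b) ring_scheme \<Rightarrow> ('a, 'c, 'd) module_scheme \<Rightarrow> ('a, 'e, 'f) module_scheme \<Rightarrow> ('c \<Rightarrow> 'e) set"
  where "lin_maps R M N =
    {f \<in> carrier M \<rightarrow> carrier N.
       (\<forall>x\<in>carrier M. \<forall>y\<in>carrier M. f (x \<oplus>\<^bsub>M\<^esub> y) = f x \<oplus>\<^bsub>N\<^esub> f y) \<and>
       (\<forall>a\<in>carrier R. \<forall>x\<in>carrier M. f (a \<odot>\<^bsub>M\<^esub> x) = a \<odot>\<^bsub>N\<^esub> f x)}"

text \<open>The fields \<open>mult\<close> and \<open>one\<close> of a module record carry no meaning; the values chosen here for
  the free module \<open>R\<^sup>n\<close> are the componentwise ones.\<close>

definition free_module :: "('a, 'b) ring_scheme \<Rightarrow> nat \<Rightarrow> ('a, nat \<Rightarrow> 'a) module"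
  where "free_module R n =
    \<lparr>carrier = {..<n} \<rightarrow>\<^sub>E carrier R,
     monoid.mult = (\<lambda>v w. \<lambda>i\<in>{..<n}. v i \<otimes>\<^bsub>R\<^esub> w i),
     one = (\<lambda>i\<in>{..<n}. \<one>\<^bsub>R\<^esub>),
     ring.zero = (\<lambda>i\<in>{..<n}. \<zero>\<^bsub>R\<^esub>),
     add = (\<lambda>v w. \<lambda>i\<in>{..<n}. v i \<oplus>\<^bsub>R\<^esub> w i),
     smult = (\<lambda>a v. \<lambda>i\<in>{..<n}. a \<otimes>\<^bsub>R\<^esub> v i)\<rparr>"

text \<open>There is an exact sequence \<open>0 \<rightarrow> K \<rightarrow> R\<^sup>n \<rightarrow> M \<rightarrow> 0\<close> with \<open>K\<close> finitely generated.\<close>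

definition fin_pres_module :: "('a, 'b) ring_scheme \<Rightarrow> ('a, 'c, 'd) module_scheme \<Rightarrow> bool"
  where "fin_pres_module R M \<longleftrightarrow>
    (\<exists>n. \<exists>f\<in>lin_maps R (free_module R n) M.
       f ` carrier (free_module R n) = carrier M \<and>
       fin_gen_module R
         ((free_module R n)\<lparr>carrier := a_kernel (free_module R n) M f\<rparr>))"

definition S_finite :: "'a set \<Rightarrow> ('a, 'b) ring_scheme \<Rightarrow> ('a, 'c, 'd) module_scheme \<Rightarrow> bool"
  where "S_finite S R M \<longleftrightarrow>
    (\<exists>N. \<exists>s\<in>S. submodule N R M \<and> fin_gen_module R (M\<lparr>carrier := N\<rparr>) \<and>
       (\<lambda>x. s \<odot>\<^bsub>M\<^esub> x) ` carrier M \<subseteq> N)"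

definition c_S_fin_pres :: "'a set \<Rightarrow> ('a, 'b) ring_scheme \<Rightarrow> ('a, 'c, 'd) module_scheme \<Rightarrow> bool"
  where "c_S_fin_pres S R M \<longleftrightarrow>
    (\<exists>N. \<exists>s\<in>S. submodule N R M \<and> fin_pres_module R (M\<lparr>carrier := N\<rparr>) \<and>
       (\<lambda>x. s \<odot>\<^bsub>M\<^esub> x) ` carrier M \<subseteq> N)"

definition self_module :: "('a, 'b) ring_scheme \<Rightarrow> ('a, 'a) module"
  where "self_module R =
    \<lparr>carrier = carrier R, monoid.mult = (\<otimes>\<^bsub>R\<^esub>), one = \<one>\<^bsub>R\<^esub>, ring.zero = \<zero>\<^bsub>R\<^esub>, add = (\<oplus>\<^bsub>R\<^esub>),
     smult = (\<otimes>\<^bsub>R\<^esub>)\<rparr>"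

definition ideal_module :: "('a, 'b) ring_scheme \<Rightarrow> 'a set \<Rightarrow> ('a, 'a) module"
  where "ideal_module R I = (self_module R)\<lparr>carrier := I\<rparr>"

definition fin_gen_ideal :: "'a set \<Rightarrow> ('a, 'b) ring_scheme \<Rightarrow> bool"
  where "fin_gen_ideal I R \<longleftrightarrow> (\<exists>A. finite A \<and> A \<subseteq> carrier R \<and> I = genideal R A)"

locale coherent_ring = cring R for R (structure) +
  assumes fin_gen_ideal_fin_pres: "fin_gen_ideal I R \<Longrightarrow> fin_pres_module R (ideal_module R I)"

definition c_S_coherent :: "'a set \<Rightarrow> ('a, 'b) ring_scheme \<Rightarrow> bool"
  where "c_S_coherent S R \<longleftrightarrow>
    (\<forall>I. ideal I R \<and> S_finite S R (ideal_module R I) \<longrightarrow> c_S_fin_pres S R (ideal_module R I))"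

definition frac_rel :: "('a, 'b) ring_scheme \<Rightarrow> 'a set \<Rightarrow> (('a \<times> 'a) \<times> ('a \<times> 'a)) set"
  where "frac_rel R S =
    {((a, s), (b, t)) | a s b t. a \<in> carrier R \<and> s \<in> S \<and> b \<in> carrier R \<and> t \<in> S \<and>
       (\<exists>u\<in>S. u \<otimes>\<^bsub>R\<^esub> (a \<otimes>\<^bsub>R\<^esub> t \<ominus>\<^bsub>R\<^esub> b \<otimes>\<^bsub>R\<^esub> s) = \<zero>\<^bsub>R\<^esub>)}"

definition loc_frac :: "('a, 'b) ring_scheme \<Rightarrow> 'a set \<Rightarrow> 'a \<Rightarrow> 'a \<Rightarrow> ('a \<times> 'a) set"
  where "loc_frac R S a s = frac_rel R S `` {(a, s)}"

text \<open>Each union below ranges over the representatives of the classes and is a single class, because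
  the operations do not depend on representatives (see \<open>mult_loc_frac\<close> and \<open>add_loc_frac\<close>).\<close>

definition localization :: "('a, 'b) ring_scheme \<Rightarrow> 'a set \<Rightarrow> ('a \<times> 'a) set ring"
  where "localization R S =
    \<lparr>carrier = (carrier R \<times> S) // frac_rel R S,
     monoid.mult = (\<lambda>A B. \<Union>x\<in>A. \<Union>y\<in>B.
       loc_frac R S (fst x \<otimes>\<^bsub>R\<^esub> fst y) (snd x \<otimes>\<^bsub>R\<^esub> snd y)),
     one = loc_frac R S \<one>\<^bsub>R\<^esub> \<one>\<^bsub>R\<^esub>,
     ring.zero = loc_frac R S \<zero>\<^bsub>R\<^esub> \<one>\<^bsub>R\<^esub>,
     add = (\<lambda>A B. \<Union>x\<in>A. \<Union>y\<in>B.
       loc_frac R S (fst x \<otimes>\<^bsub>R\<^esub> snd y \<oplus>\<^bsub>R\<^esub> fst y \<otimes>\<^bsub>R\<^esub> snd x) (snd x \<otimes>\<^bsub>R\<^esub> snd y))\<rparr>"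

definition localized_ideal :: "('a, 'b) ring_scheme \<Rightarrow> 'a set \<Rightarrow> 'a set \<Rightarrow> ('a \<times> 'a) set set"
  where "localized_ideal R S I = {loc_frac R S a s | a s. a \<in> I \<and> s \<in> S}"

lemma (in cring) module_free_module: "module R (free_module R n)"
proof (rule moduleI[OF is_cring])
  show "abelian_group (free_module R n)"
  proof (rule abelian_groupI)
    fix x assume "x \<in> carrier (free_module R n)"
    then show "\<exists>y\<in>carrier (free_module R n). y \<oplus>\<^bsub>free_module R n\<^esub> x = \<zero>\<^bsub>free_module R n\<^esub>"
      by (intro bexI[of _ "\<lambda>i\<in>{..<n}. \<ominus> x i"])
        (auto simp: free_module_def PiE_iff l_neg intro!: restrict_ext)
  next
    fix x assume "x \<in> carrier (free_module R n)"
    then show "\<zero>\<^bsub>free_module R n\<^esub> \<oplus>\<^bsub>free_module R n\<^esub> x = x"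
      by (auto simp: free_module_def PiE_iff extensional_def fun_eq_iff)
  qed (auto simp: free_module_def PiE_iff a_ac intro!: restrict_ext)
next
  fix x assume "x \<in> carrier (free_module R n)"
  then show "\<one> \<odot>\<^bsub>free_module R n\<^esub> x = x"
    by (auto simp: free_module_def PiE_iff extensional_def fun_eq_iff)
qed (auto simp: free_module_def PiE_iff l_distr r_distr m_assoc intro!: restrict_ext)

lemma (in cring) module_self_module: "module R (self_module R)"
proof (rule moduleI[OF is_cring])
  show "abelian_group (self_module R)"
  proof (rule abelian_groupI)
    fix x assume "x \<in> carrier (self_module R)"
    then show "\<exists>y\<in>carrier (self_module R). y \<oplus>\<^bsub>self_module R\<^esub> x = \<zero>\<^bsub>self_module R\<^esub>"
      by (intro bexI[of _ "\<ominus> x"]) (auto simp: self_module_def l_neg)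
  qed (auto simp: self_module_def a_ac)
qed (auto simp: self_module_def l_distr r_distr m_assoc)

lemma (in cring) submodule_self_module_iff: "submodule I R (self_module R) \<longleftrightarrow> ideal I R"
proof -
  interpret M: module R "self_module R" by (rule module_self_module)
  have inv: "inv\<^bsub>add_monoid (self_module R)\<^esub> x = inv\<^bsub>add_monoid R\<^esub> x" for x
    by (simp add: self_module_def m_inv_def)
  have sub: "subgroup I (add_monoid (self_module R)) \<longleftrightarrow> subgroup I (add_monoid R)"
    by (auto simp: subgroup_def inv) (auto simp: self_module_def)
  show ?thesis
  proof
    assume I: "submodule I R (self_module R)"
    then interpret I: submodule I R "self_module R" .
    have H: "subgroup I (add_monoid R)" using I.subgroup_axioms sub by blast
    have "a \<otimes> x \<in> I" if "a \<in> I" "x \<in> carrier R" for a x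
      using I.smult_closed[OF that(2,1)] that subgroup.subset[OF H]
      by (auto simp: self_module_def m_comm subset_eq)
    moreover have "x \<otimes> a \<in> I" if "a \<in> I" "x \<in> carrier R" for a x
      using I.smult_closed[OF that(2,1)] by (simp add: self_module_def)
    ultimately show "ideal I R" by (intro idealI ring_axioms H)
  next
    assume "ideal I R"
    then interpret I: ideal I R .
    show "submodule I R (self_module R)"
    proof (intro submodule.intro submodule_axioms.intro)
      show "subgroup I (add_monoid (self_module R))" using I.a_subgroup by (simp only: sub)
      show "a \<odot>\<^bsub>self_module R\<^esub> x \<in> I" if "a \<in> carrier R" "x \<in> I" for a x
        using that by (simp add: self_module_def I.I_l_closed)
    qed
  qed
qed

lemma (in cring) module_ideal_module: "ideal I R \<Longrightarrow> module R (ideal_module R I)"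
  unfolding ideal_module_def
  by (intro submodule.submodule_is_module module_self_module) (simp add: submodule_self_module_iff)

lemma (in cring) submodule_ideal_module_iff:
  assumes "ideal I R"
  shows "submodule N R (ideal_module R I) \<longleftrightarrow> ideal N R \<and> N \<subseteq> I"
proof -
  have eq: "(ideal_module R I)\<lparr>carrier := N\<rparr> = (self_module R)\<lparr>carrier := N\<rparr>" for N
    by (simp add: ideal_module_def)
  have I: "I \<subseteq> carrier R" using ideal.Icarr[OF assms] by blast
  have car: "carrier (ideal_module R I) = I" "carrier (self_module R) = carrier R"
    by (simp_all add: ideal_module_def self_module_def)
  note M = module_ideal_module[OF assms] and M' = module_self_module
  have "submodule N R (ideal_module R I) \<longleftrightarrow>
      N \<subseteq> I \<and> module R ((ideal_module R I)\<lparr>carrier := N\<rparr>)"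
    using module.module_incl_imp_submodule[OF M, of N, unfolded car]
      submodule.submodule_is_module[OF _ M, of N] module.submoduleE(1)[OF M, of N, unfolded car]
    by metis
  also have "\<dots> \<longleftrightarrow> N \<subseteq> I \<and> submodule N R (self_module R)"
    unfolding eq
    using module.module_incl_imp_submodule[OF M', of N, unfolded car]
      submodule.submodule_is_module[OF _ M', of N] subset_trans[OF _ I, of N]
    by metis
  also have "\<dots> \<longleftrightarrow> ideal N R \<and> N \<subseteq> I"
    unfolding submodule_self_module_iff by (rule conj_commute)
  finally show ?thesis .
qed

lemma (in cring) gen_submodule_ideal_module:
  assumes I: "ideal I R" and A: "A \<subseteq> I"
  shows "gen_submodule R (ideal_module R I) A = genideal R A"
proof -
  have "A \<subseteq> carrier R" using A ideal.Icarr[OF I] by auto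
  then have G: "ideal (genideal R A) R" "A \<subseteq> genideal R A"
    by (rule genideal_ideal, rule genideal_self)
  have "genideal R A \<subseteq> I" by (rule genideal_minimal[OF I A])
  then have "gen_submodule R (ideal_module R I) A \<subseteq> genideal R A"
    unfolding gen_submodule_def submodule_ideal_module_iff[OF I] using G
    by (intro Inter_lower) simp
  moreover have "genideal R A \<subseteq> gen_submodule R (ideal_module R I) A"
    unfolding gen_submodule_def submodule_ideal_module_iff[OF I]
    by (intro Inter_greatest genideal_minimal) simp_all
  ultimately show ?thesis by (rule equalityI)
qed

lemma (in cring) fin_gen_ideal_iff:
  "fin_gen_ideal I R \<longleftrightarrow> ideal I R \<and> fin_gen_module R (ideal_module R I)"
proof
  have car: "carrier (ideal_module R I) = I" by (simp add: ideal_module_def)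
  assume "fin_gen_ideal I R"
  then obtain A where A: "finite A" "A \<subseteq> carrier R" "I = genideal R A"
    unfolding fin_gen_ideal_def by auto
  have I: "ideal I R" unfolding A(3) by (rule genideal_ideal[OF A(2)])
  have AI: "A \<subseteq> I" unfolding A(3) by (rule genideal_self[OF A(2)])
  have "I = gen_submodule R (ideal_module R I) A"
    using gen_submodule_ideal_module[OF I AI] A(3) by metis
  then show "ideal I R \<and> fin_gen_module R (ideal_module R I)"
    unfolding fin_gen_module_def car using I A(1) AI by metis
next
  have car: "carrier (ideal_module R I) = I" by (simp add: ideal_module_def)
  assume "ideal I R \<and> fin_gen_module R (ideal_module R I)"
  then have I: "ideal I R" and fg: "fin_gen_module R (ideal_module R I)" by simp_all
  from fg obtain A where A: "finite A" "A \<subseteq> I" "I = gen_submodule R (ideal_module R I) A"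
    unfolding fin_gen_module_def car by auto
  have "A \<subseteq> carrier R" using A(2) ideal.Icarr[OF I] by auto
  moreover have "I = genideal R A"
    using gen_submodule_ideal_module[OF I A(2)] A(3) by metis
  ultimately show "fin_gen_ideal I R"
    unfolding fin_gen_ideal_def using A(1) by metis
qed

locale mult_subset_cring = cring R + S: submonoid S R for R (structure) and S
begin

lemma mult_subset [simp]:
  shows "S \<subseteq> carrier R" "\<one> \<in> S" "s \<in> S \<Longrightarrow> s \<in> carrier R"
    "s \<in> S \<Longrightarrow> t \<in> S \<Longrightarrow> s \<otimes> t \<in> S"
  using S.subset by auto

lemma frac_rel_iff:
  "((a, s), (b, t)) \<in> frac_rel R S \<longleftrightarrow> a \<in> carrier R \<and> s \<in> S \<and> b \<in> carrier R \<and> t \<in> S \<and>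
     (\<exists>u\<in>S. u \<otimes> (a \<otimes> t) = u \<otimes> (b \<otimes> s))"
proof -
  have "u \<otimes> (a \<otimes> t \<ominus> b \<otimes> s) = \<zero> \<longleftrightarrow> u \<otimes> (a \<otimes> t) = u \<otimes> (b \<otimes> s)"
    if "a \<in> carrier R" "s \<in> S" "b \<in> carrier R" "t \<in> S" "u \<in> S" for u
  proof -
    have "u \<otimes> (a \<otimes> t \<ominus> b \<otimes> s) = u \<otimes> (a \<otimes> t) \<ominus> u \<otimes> (b \<otimes> s)"
      using that by (simp add: minus_eq r_distr r_minus)
    then show ?thesis using that by simp
  qed
  then show ?thesis by (auto simp: frac_rel_def)
qed

lemma equiv_frac_rel: "equiv (carrier R \<times> S) (frac_rel R S)"
proof (rule equivI)
  show "frac_rel R S \<subseteq> (carrier R \<times> S) \<times> (carrier R \<times> S)"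
    by (auto simp: frac_rel_iff)
  show "refl_on (carrier R \<times> S) (frac_rel R S)"
    by (auto simp: refl_on_def frac_rel_iff intro!: bexI[of _ \<one>])
  show "sym (frac_rel R S)"
    by (auto simp: sym_def frac_rel_iff) metis
  show "trans (frac_rel R S)"
  proof (rule transI, clarsimp simp: frac_rel_iff)
    fix a s b t c r u v
    assume c: "a \<in> carrier R" "s \<in> S" "b \<in> carrier R" "t \<in> S" "c \<in> carrier R" "r \<in> S"
      "u \<in> S" "v \<in> S" and e: "u \<otimes> (a \<otimes> t) = u \<otimes> (b \<otimes> s)" "v \<otimes> (b \<otimes> r) = v \<otimes> (c \<otimes> t)"
    have "u \<otimes> v \<otimes> t \<otimes> (a \<otimes> r) = (v \<otimes> r) \<otimes> (u \<otimes> (a \<otimes> t))" using c by (simp add: m_ac)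
    also have "\<dots> = (u \<otimes> s) \<otimes> (v \<otimes> (b \<otimes> r))" using c by (simp add: e(1) m_ac)
    also have "\<dots> = u \<otimes> v \<otimes> t \<otimes> (c \<otimes> s)" using c by (simp add: e(2) m_ac)
    finally show "\<exists>w\<in>S. w \<otimes> (a \<otimes> r) = w \<otimes> (c \<otimes> s)"
      using c by (intro bexI[of _ "u \<otimes> v \<otimes> t"]) auto
  qed
qed

lemma loc_frac_eq_iff:
  "\<lbrakk>a \<in> carrier R; s \<in> S; b \<in> carrier R; t \<in> S\<rbrakk> \<Longrightarrow>
    loc_frac R S a s = loc_frac R S b t \<longleftrightarrow> (\<exists>u\<in>S. u \<otimes> (a \<otimes> t) = u \<otimes> (b \<otimes> s))"
  unfolding loc_frac_def
  by (subst eq_equiv_class_iff[OF equiv_frac_rel]) (auto simp: frac_rel_iff)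

lemma loc_frac_self: "\<lbrakk>a \<in> carrier R; s \<in> S\<rbrakk> \<Longrightarrow> (a, s) \<in> loc_frac R S a s"
  by (auto simp: loc_frac_def frac_rel_iff intro!: bexI[of _ \<one>])

lemma carrier_localization:
  "carrier (localization R S) = {loc_frac R S a s | a s. a \<in> carrier R \<and> s \<in> S}"
  by (auto simp: localization_def quotient_def loc_frac_def)

lemma mult_loc_frac:
  assumes c: "a \<in> carrier R" "s \<in> S" "b \<in> carrier R" "t \<in> S"
  shows "loc_frac R S a s \<otimes>\<^bsub>localization R S\<^esub> loc_frac R S b t = loc_frac R S (a \<otimes> b) (s \<otimes> t)"
proof -
  have "loc_frac R S (fst x \<otimes> fst y) (snd x \<otimes> snd y) = loc_frac R S (a \<otimes> b) (s \<otimes> t)"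
    if xin: "x \<in> loc_frac R S a s" and yin: "y \<in> loc_frac R S b t" for x y
  proof -
    obtain a' s' u where x: "x = (a', s')" "a' \<in> carrier R" "s' \<in> S" "u \<in> S"
      "u \<otimes> (a \<otimes> s') = u \<otimes> (a' \<otimes> s)"
      using xin by (cases x) (auto simp: loc_frac_def frac_rel_iff)
    obtain b' t' v where y: "y = (b', t')" "b' \<in> carrier R" "t' \<in> S" "v \<in> S"
      "v \<otimes> (b \<otimes> t') = v \<otimes> (b' \<otimes> t)"
      using yin by (cases y) (auto simp: loc_frac_def frac_rel_iff)
    have "u \<otimes> v \<otimes> (a' \<otimes> b' \<otimes> (s \<otimes> t)) = (u \<otimes> (a' \<otimes> s)) \<otimes> (v \<otimes> (b' \<otimes> t))"
      using c x y by (simp add: m_ac)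
    also have "\<dots> = (u \<otimes> (a \<otimes> s')) \<otimes> (v \<otimes> (b \<otimes> t'))" using x y by simp
    also have "\<dots> = u \<otimes> v \<otimes> (a \<otimes> b \<otimes> (s' \<otimes> t'))" using c x(2-4) y(2-4) by (simp add: m_ac)
    finally show ?thesis
      using c x y by (auto simp: loc_frac_eq_iff intro!: bexI[of _ "u \<otimes> v"])
  qed
  then show ?thesis
    using loc_frac_self[OF c(1,2)] loc_frac_self[OF c(3,4)] by (auto simp: localization_def)
qed

lemma add_loc_frac:
  assumes c: "a \<in> carrier R" "s \<in> S" "b \<in> carrier R" "t \<in> S"
  shows "loc_frac R S a s \<oplus>\<^bsub>localization R S\<^esub> loc_frac R S b t =
    loc_frac R S (a \<otimes> t \<oplus> b \<otimes> s) (s \<otimes> t)"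
proof -
  have "loc_frac R S (fst x \<otimes> snd y \<oplus> fst y \<otimes> snd x) (snd x \<otimes> snd y) =
      loc_frac R S (a \<otimes> t \<oplus> b \<otimes> s) (s \<otimes> t)"
    if xin: "x \<in> loc_frac R S a s" and yin: "y \<in> loc_frac R S b t" for x y
  proof -
    obtain a' s' u where x: "x = (a', s')" "a' \<in> carrier R" "s' \<in> S" "u \<in> S"
      "u \<otimes> (a \<otimes> s') = u \<otimes> (a' \<otimes> s)"
      using xin by (cases x) (auto simp: loc_frac_def frac_rel_iff)
    obtain b' t' v where y: "y = (b', t')" "b' \<in> carrier R" "t' \<in> S" "v \<in> S"
      "v \<otimes> (b \<otimes> t') = v \<otimes> (b' \<otimes> t)"
      using yin by (cases y) (auto simp: loc_frac_def frac_rel_iff)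
    have "u \<otimes> v \<otimes> ((a' \<otimes> t' \<oplus> b' \<otimes> s') \<otimes> (s \<otimes> t)) =
        (v \<otimes> t' \<otimes> t) \<otimes> (u \<otimes> (a' \<otimes> s)) \<oplus> (u \<otimes> s' \<otimes> s) \<otimes> (v \<otimes> (b' \<otimes> t))"
      using c x y by (simp add: m_ac l_distr r_distr)
    also have "\<dots> = (v \<otimes> t' \<otimes> t) \<otimes> (u \<otimes> (a \<otimes> s')) \<oplus> (u \<otimes> s' \<otimes> s) \<otimes> (v \<otimes> (b \<otimes> t'))"
      using x y by simp
    also have "\<dots> = u \<otimes> v \<otimes> ((a \<otimes> t \<oplus> b \<otimes> s) \<otimes> (s' \<otimes> t'))"
      using c x(2-4) y(2-4) by (simp add: m_ac l_distr r_distr)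
    finally show ?thesis
      using c x y by (auto simp: loc_frac_eq_iff intro!: bexI[of _ "u \<otimes> v"])
  qed
  then show ?thesis
    using loc_frac_self[OF c(1,2)] loc_frac_self[OF c(3,4)] by (auto simp: localization_def)
qed

lemma one_zero_localization:
  "\<one>\<^bsub>localization R S\<^esub> = loc_frac R S \<one> \<one>" "\<zero>\<^bsub>localization R S\<^esub> = loc_frac R S \<zero> \<one>"
  by (simp_all add: localization_def)

lemma loc_frac_eqI:
  "\<lbrakk>a \<otimes> t = b \<otimes> s; a \<in> carrier R; s \<in> S; b \<in> carrier R; t \<in> S\<rbrakk> \<Longrightarrow>
    loc_frac R S a s = loc_frac R S b t"
  by (auto simp: loc_frac_eq_iff intro!: bexI[of _ \<one>])

lemma loc_frac_in_carrier:
  "\<lbrakk>a \<in> carrier R; s \<in> S\<rbrakk> \<Longrightarrow> loc_frac R S a s \<in> carrier (localization R S)"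
  by (auto simp: carrier_localization)

lemma carrier_localizationE:
  assumes "x \<in> carrier (localization R S)"
  obtains a s where "x = loc_frac R S a s" "a \<in> carrier R" "s \<in> S"
  using assms by (auto simp: carrier_localization)

lemmas loc_frac_simps = one_zero_localization add_loc_frac mult_loc_frac loc_frac_in_carrier

lemma cring_localization: "cring (localization R S)"
proof (rule cringI)
  show "abelian_group (localization R S)"
  proof (rule abelian_groupI)
    fix x assume "x \<in> carrier (localization R S)"
    then obtain a s where x: "x = loc_frac R S a s" "a \<in> carrier R" "s \<in> S"
      by (rule carrier_localizationE)
    have "loc_frac R S (\<ominus> a) s \<oplus>\<^bsub>localization R S\<^esub> x = loc_frac R S (\<ominus> a \<otimes> s \<oplus> a \<otimes> s) (s \<otimes> s)"
      using x by (simp add: loc_frac_simps)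
    also have "\<dots> = \<zero>\<^bsub>localization R S\<^esub>"
      unfolding one_zero_localization
      by (rule loc_frac_eqI) (use x in \<open>auto simp: l_minus l_neg\<close>)
    finally show "\<exists>y\<in>carrier (localization R S). y \<oplus>\<^bsub>localization R S\<^esub> x = \<zero>\<^bsub>localization R S\<^esub>"
      using x by (intro bexI[of _ "loc_frac R S (\<ominus> a) s"]) (auto simp: loc_frac_simps)
  next
    fix x y z
    assume "x \<in> carrier (localization R S)" "y \<in> carrier (localization R S)"
      "z \<in> carrier (localization R S)"
    then show "(x \<oplus>\<^bsub>localization R S\<^esub> y) \<oplus>\<^bsub>localization R S\<^esub> z =
        x \<oplus>\<^bsub>localization R S\<^esub> (y \<oplus>\<^bsub>localization R S\<^esub> z)"
      by (elim carrier_localizationE) (simp add: loc_frac_simps l_distr r_distr m_ac a_ac)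
  next
    fix x y assume "x \<in> carrier (localization R S)" "y \<in> carrier (localization R S)"
    then show "x \<oplus>\<^bsub>localization R S\<^esub> y = y \<oplus>\<^bsub>localization R S\<^esub> x"
      "x \<oplus>\<^bsub>localization R S\<^esub> y \<in> carrier (localization R S)"
      by (elim carrier_localizationE; simp add: loc_frac_simps m_ac a_ac)+
  next
    fix x assume "x \<in> carrier (localization R S)"
    then show "\<zero>\<^bsub>localization R S\<^esub> \<oplus>\<^bsub>localization R S\<^esub> x = x"
      by (elim carrier_localizationE) (simp add: loc_frac_simps)
  next
    show "\<zero>\<^bsub>localization R S\<^esub> \<in> carrier (localization R S)"
      by (simp add: loc_frac_simps)
  qed
  show "comm_monoid (localization R S)"
  proof (rule comm_monoidI)
    fix x y z
    assume "x \<in> carrier (localization R S)" "y \<in> carrier (localization R S)"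
      "z \<in> carrier (localization R S)"
    then show "(x \<otimes>\<^bsub>localization R S\<^esub> y) \<otimes>\<^bsub>localization R S\<^esub> z =
        x \<otimes>\<^bsub>localization R S\<^esub> (y \<otimes>\<^bsub>localization R S\<^esub> z)"
      by (elim carrier_localizationE) (simp add: loc_frac_simps m_ac)
  next
    fix x y assume "x \<in> carrier (localization R S)" "y \<in> carrier (localization R S)"
    then show "x \<otimes>\<^bsub>localization R S\<^esub> y = y \<otimes>\<^bsub>localization R S\<^esub> x"
      "x \<otimes>\<^bsub>localization R S\<^esub> y \<in> carrier (localization R S)"
      by (elim carrier_localizationE; simp add: loc_frac_simps m_ac)+
  next
    fix x assume "x \<in> carrier (localization R S)"
    then show "\<one>\<^bsub>localization R S\<^esub> \<otimes>\<^bsub>localization R S\<^esub> x = x"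
      by (elim carrier_localizationE) (simp add: loc_frac_simps)
  next
    show "\<one>\<^bsub>localization R S\<^esub> \<in> carrier (localization R S)"
      by (simp add: loc_frac_simps)
  qed
next
  fix x y z
  assume "x \<in> carrier (localization R S)" "y \<in> carrier (localization R S)"
    "z \<in> carrier (localization R S)"
  then show "(x \<oplus>\<^bsub>localization R S\<^esub> y) \<otimes>\<^bsub>localization R S\<^esub> z =
      x \<otimes>\<^bsub>localization R S\<^esub> z \<oplus>\<^bsub>localization R S\<^esub> y \<otimes>\<^bsub>localization R S\<^esub> z"
  proof (elim carrier_localizationE)
    fix a s b t c r
    assume c: "a \<in> carrier R" "s \<in> S" "b \<in> carrier R" "t \<in> S" "c \<in> carrier R" "r \<in> S"
      and xyz: "x = loc_frac R S a s" "y = loc_frac R S b t" "z = loc_frac R S c r"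
    have "loc_frac R S ((a \<otimes> t \<oplus> b \<otimes> s) \<otimes> c) (s \<otimes> t \<otimes> r) =
        loc_frac R S (a \<otimes> c \<otimes> (t \<otimes> r) \<oplus> b \<otimes> c \<otimes> (s \<otimes> r)) (s \<otimes> r \<otimes> (t \<otimes> r))"
      by (rule loc_frac_eqI) (use c in \<open>simp_all add: l_distr r_distr m_ac\<close>)
    then show ?thesis
      using c by (simp add: xyz loc_frac_simps)
  qed
qed

lemma ideal_localized_ideal:
  assumes "ideal I R"
  shows "ideal (localized_ideal R S I) (localization R S)"
proof -
  interpret I: ideal I R by fact
  interpret L: cring "localization R S" by (rule cring_localization)
  have I_carrier: "a \<in> carrier R" if "a \<in> I" for a using that by (rule I.Icarr)
  have mem: "loc_frac R S a s \<in> localized_ideal R S I" if "a \<in> I" "s \<in> S" for a s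
    using that by (auto simp: localized_ideal_def)
  have memE: thesis if "x \<in> localized_ideal R S I"
    "\<And>a s. \<lbrakk>x = loc_frac R S a s; a \<in> I; s \<in> S\<rbrakk> \<Longrightarrow> thesis" for x thesis
    using that by (auto simp: localized_ideal_def)
  have absorb: "x \<otimes>\<^bsub>localization R S\<^esub> y \<in> localized_ideal R S I"
    if "x \<in> localized_ideal R S I" "y \<in> carrier (localization R S)" for x y
    using that
    by (elim memE carrier_localizationE) (simp add: mult_loc_frac I_carrier mem I.I_r_closed)
  have sub: "localized_ideal R S I \<subseteq> carrier (localization R S)"
    by (auto elim!: memE simp: loc_frac_in_carrier I_carrier)
  show ?thesis
  proof (rule idealI)
    show "ring (localization R S)" by (rule L.ring_axioms)
    show "subgroup (localized_ideal R S I) (add_monoid (localization R S))"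
    proof (rule L.add.subgroupI)
      show "localized_ideal R S I \<subseteq> carrier (localization R S)" by (rule sub)
      show "localized_ideal R S I \<noteq> {}"
        using mem[OF I.zero_closed mult_subset(2)] by blast
    next
      fix x assume x: "x \<in> localized_ideal R S I"
      have "\<ominus>\<^bsub>localization R S\<^esub> x =
          x \<otimes>\<^bsub>localization R S\<^esub> (\<ominus>\<^bsub>localization R S\<^esub> \<one>\<^bsub>localization R S\<^esub>)"
        using x sub by (simp add: L.r_minus subset_eq)
      then show "\<ominus>\<^bsub>localization R S\<^esub> x \<in> localized_ideal R S I"
        using absorb[OF x] by simp
    next
      fix x y assume "x \<in> localized_ideal R S I" "y \<in> localized_ideal R S I"
      then show "x \<oplus>\<^bsub>localization R S\<^esub> y \<in> localized_ideal R S I"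
        by (elim memE) (simp add: add_loc_frac I_carrier mem I.I_r_closed I.a_closed)
    qed
  next
    fix x y assume "x \<in> localized_ideal R S I" "y \<in> carrier (localization R S)"
    with absorb[OF this] sub show "x \<otimes>\<^bsub>localization R S\<^esub> y \<in> localized_ideal R S I"
      "y \<otimes>\<^bsub>localization R S\<^esub> x \<in> localized_ideal R S I"
      using L.m_comm[of x y] by auto
  qed
qed

end

end

theory Submission
  imports Defs
begin

text \<open>The equivalences amount to multiplying out finitely many denominators: for a finitely
  generated ideal \<open>I \<supseteq> J\<close> one has \<open>I\<^sub>S = J\<^sub>S\<close> iff \<open>s I \<subseteq> J\<close> for some \<open>s \<in> S\<close>. For the coherence of
  \<open>R\<^sub>S\<close>, every finitely generated ideal of \<open>R\<^sub>S\<close> is some \<open>I\<^sub>S = J\<^sub>S\<close>, and a finite presentation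
  \<open>f : R\<^sup>n \<rightarrow> J\<close> localizes: every vector over \<open>R\<^sub>S\<close> has the form \<open>c/s\<close> with a common denominator, so
  \<open>f\<close> induces \<open>c/s \<mapsto> f c/s\<close>, and the kernel of this map is generated by the images \<open>b/1\<close> of the
  generators of the kernel of \<open>f\<close>.\<close>

section \<open>Submodules, finite generation and linear maps\<close>

lemma (in module) submodule_add_smultI:
  assumes "H \<subseteq> carrier M" "\<zero>\<^bsub>M\<^esub> \<in> H"
    and "\<And>a b. \<lbrakk>a \<in> H; b \<in> H\<rbrakk> \<Longrightarrow> a \<oplus>\<^bsub>M\<^esub> b \<in> H"
    and smult: "\<And>a x. \<lbrakk>a \<in> carrier R; x \<in> H\<rbrakk> \<Longrightarrow> a \<odot>\<^bsub>M\<^esub> x \<in> H"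
  shows "submodule H R M"
proof (rule submoduleI)
  fix x assume x: "x \<in> H"
  \<comment> \<open>Negation is scalar multiplication by -1, so closure under negatives comes from
    closure under scalars.\<close>
  then have "\<ominus>\<^bsub>M\<^esub> x = (\<ominus> \<one>) \<odot>\<^bsub>M\<^esub> x"
    using assms(1) by (auto simp: smult_l_minus)
  then show "\<ominus>\<^bsub>M\<^esub> x \<in> H"
    using smult[OF _ x] by simp
qed (use assms in auto)

text \<open>A subset is a submodule exactly when it is a module for the restricted operations, and
  these are the same whether restricted from \<open>K\<close> or from \<open>M\<close>.\<close>

lemma (in module) submodule_of_submodule_iff:
  assumes "submodule K R M"
  shows "submodule N R (M\<lparr>carrier := K\<rparr>) \<longleftrightarrow> submodule N R M \<and> N \<subseteq> K"
proof -
  have K: "module R (M\<lparr>carrier := K\<rparr>)" "K \<subseteq> carrier M"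
    using submodule.submodule_is_module[OF assms module_axioms] submoduleE(1)[OF assms] by auto
  have "submodule N R (M\<lparr>carrier := K\<rparr>) \<longleftrightarrow> N \<subseteq> K \<and> module R (M\<lparr>carrier := N\<rparr>)"
    using module.module_incl_imp_submodule[OF K(1), of N] module.submoduleE(1)[OF K(1), of N]
      submodule.submodule_is_module[OF _ K(1), of N] by auto
  also have "\<dots> \<longleftrightarrow> submodule N R M \<and> N \<subseteq> K"
    using module_incl_imp_submodule[of N] submodule.submodule_is_module[OF _ module_axioms, of N] K(2)
    by blast
  finally show ?thesis .
qed

text \<open>\<open>K\<close> is itself a submodule containing \<open>B\<close>, so the intersection
  in \<open>gen_submodule\<close> equals \<open>K\<close> iff every submodule between
  \<open>B\<close> and \<open>K\<close> is \<open>K\<close>. This minimality form stays inside the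
  ambient \<open>M\<close> and is how generation of kernels is used and proved below.\<close>

lemma (in module) fin_gen_submodule_iff:
  assumes K: "submodule K R M"
  shows "fin_gen_module R (M\<lparr>carrier := K\<rparr>) \<longleftrightarrow>
    (\<exists>B. finite B \<and> B \<subseteq> K \<and> (\<forall>N. submodule N R M \<longrightarrow> B \<subseteq> N \<longrightarrow> N \<subseteq> K \<longrightarrow> N = K))"
proof -
  have "K = gen_submodule R (M\<lparr>carrier := K\<rparr>) B \<longleftrightarrow>
      (\<forall>N. submodule N R M \<longrightarrow> B \<subseteq> N \<longrightarrow> N \<subseteq> K \<longrightarrow> N = K)" if "B \<subseteq> K" for B
    unfolding gen_submodule_def submodule_of_submodule_iff[OF K] using that K by blast
  then show ?thesis
    by (auto simp: fin_gen_module_def)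
qed

lemma lin_mapsD:
  assumes "f \<in> lin_maps R M N"
  shows "x \<in> carrier M \<Longrightarrow> f x \<in> carrier N"
    and "\<lbrakk>x \<in> carrier M; y \<in> carrier M\<rbrakk> \<Longrightarrow> f (x \<oplus>\<^bsub>M\<^esub> y) = f x \<oplus>\<^bsub>N\<^esub> f y"
    and "\<lbrakk>a \<in> carrier R; x \<in> carrier M\<rbrakk> \<Longrightarrow> f (a \<odot>\<^bsub>M\<^esub> x) = a \<odot>\<^bsub>N\<^esub> f x"
  using assms by (auto simp: lin_maps_def)

lemma lin_maps_zero:
  assumes "module R M" "module R N" and f: "f \<in> lin_maps R M N"
  shows "f \<zero>\<^bsub>M\<^esub> = \<zero>\<^bsub>N\<^esub>"
proof -
  interpret M: module R M by fact
  interpret N: module R N by fact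
  have "f \<zero>\<^bsub>M\<^esub> \<oplus>\<^bsub>N\<^esub> f \<zero>\<^bsub>M\<^esub> = f \<zero>\<^bsub>M\<^esub>"
    using lin_mapsD(2)[OF f M.zero_closed M.zero_closed] by simp
  then show ?thesis
    using lin_mapsD(1)[OF f M.zero_closed] by simp
qed

lemma submodule_a_kernel:
  assumes "module R M" "module R N" and f: "f \<in> lin_maps R M N"
  shows "submodule (a_kernel M N f) R M"
proof -
  interpret M: module R M by fact
  interpret N: module R N by fact
  show ?thesis
    by (rule M.submodule_add_smultI)
      (auto simp: a_kernel_def' lin_maps_zero[OF assms] lin_mapsD[OF f] N.smult_r_null)
qed

section \<open>Free modules, and ideals regarded as modules\<close>

lemma (in cring) free_module_simps:
  "carrier (free_module R n) = {..<n} \<rightarrow>\<^sub>E carrier R"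
  "\<zero>\<^bsub>free_module R n\<^esub> = (\<lambda>i\<in>{..<n}. \<zero>)"
  "v \<oplus>\<^bsub>free_module R n\<^esub> w = (\<lambda>i\<in>{..<n}. v i \<oplus> w i)"
  "a \<odot>\<^bsub>free_module R n\<^esub> v = (\<lambda>i\<in>{..<n}. a \<otimes> v i)"
  by (simp_all add: free_module_def)

lemma ideal_module_simps [simp]:
  "carrier (ideal_module R I) = I"
  "\<zero>\<^bsub>ideal_module R I\<^esub> = \<zero>\<^bsub>R\<^esub>"
  "x \<oplus>\<^bsub>ideal_module R I\<^esub> y = x \<oplus>\<^bsub>R\<^esub> y"
  "a \<odot>\<^bsub>ideal_module R I\<^esub> x = a \<otimes>\<^bsub>R\<^esub> x"
  "(ideal_module R I)\<lparr>carrier := N\<rparr> = ideal_module R N"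
  by (simp_all add: ideal_module_def self_module_def)

lemma (in cring) fin_gen_ideal_imp_ideal: "fin_gen_ideal I R \<Longrightarrow> ideal I R"
  by (simp add: fin_gen_ideal_iff)

text \<open>The submodules of an ideal \<open>I\<close> are the ideals contained in
  \<open>I\<close>; this and the next lemma thereby move the module notions into the ideals of
  \<open>R\<close>.\<close>

lemma (in cring) S_finite_ideal_iff:
  assumes "ideal I R"
  shows "S_finite S R (ideal_module R I) \<longleftrightarrow>
    (\<exists>N. \<exists>s\<in>S. fin_gen_ideal N R \<and> N \<subseteq> I \<and> (\<forall>x\<in>I. s \<otimes> x \<in> N))"
  unfolding S_finite_def submodule_ideal_module_iff[OF assms] fin_gen_ideal_iff
  by (auto simp: image_subset_iff)

lemma (in cring) c_S_fin_pres_ideal_iff: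
  assumes "ideal I R"
  shows "c_S_fin_pres S R (ideal_module R I) \<longleftrightarrow>
    (\<exists>J. \<exists>s\<in>S. ideal J R \<and> J \<subseteq> I \<and> fin_pres_module R (ideal_module R J) \<and> (\<forall>x\<in>I. s \<otimes> x \<in> J))"
  unfolding c_S_fin_pres_def submodule_ideal_module_iff[OF assms]
  by (auto simp: image_subset_iff)

section \<open>Reduction of c-S-coherence to finitely generated ideals\<close>

context mult_subset_cring
begin

text \<open>A finitely generated ideal is S-finite with multiplier 1. Conversely, if s I \<subseteq>
  N \<subseteq> I with N finitely generated, and t N \<subseteq> J \<subseteq> N with J finitely
  presented, then (t s) I \<subseteq> J \<subseteq> I.\<close>

lemma c_S_coherent_iff:
  "c_S_coherent S R \<longleftrightarrow> (\<forall>I. fin_gen_ideal I R \<longrightarrow> c_S_fin_pres S R (ideal_module R I))"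
proof (intro iffI allI impI)
  fix I assume coh: "c_S_coherent S R" and I: "fin_gen_ideal I R"
  have id: "ideal I R" by (rule fin_gen_ideal_imp_ideal[OF I])
  then have "\<forall>x\<in>I. \<one> \<otimes> x \<in> I" by (simp add: ideal.Icarr)
  then have "S_finite S R (ideal_module R I)"
    unfolding S_finite_ideal_iff[OF id] using I mult_subset(2) by blast
  then show "c_S_fin_pres S R (ideal_module R I)"
    using coh id by (simp add: c_S_coherent_def)
next
  assume fp: "\<forall>I. fin_gen_ideal I R \<longrightarrow> c_S_fin_pres S R (ideal_module R I)"
  show "c_S_coherent S R"
    unfolding c_S_coherent_def
  proof (intro allI impI, elim conjE)
    fix I assume I: "ideal I R" and "S_finite S R (ideal_module R I)"
    then obtain N s where N: "fin_gen_ideal N R" "N \<subseteq> I" "s \<in> S" "\<forall>x\<in>I. s \<otimes> x \<in> N"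
      unfolding S_finite_ideal_iff[OF I] by blast
    then obtain J t where J: "ideal J R" "J \<subseteq> N" "fin_pres_module R (ideal_module R J)"
      "t \<in> S" "\<forall>x\<in>N. t \<otimes> x \<in> J"
      using fp c_S_fin_pres_ideal_iff[OF fin_gen_ideal_imp_ideal[OF N(1)]] by blast
    have "t \<otimes> s \<otimes> x \<in> J" if "x \<in> I" for x
      using that N J ideal.Icarr[OF I that] by (simp add: m_assoc)
    moreover have "t \<otimes> s \<in> S" using N J by simp
    ultimately show "c_S_fin_pres S R (ideal_module R I)"
      unfolding c_S_fin_pres_ideal_iff[OF I] using N(2) J(1-3) by blast
  qed
qed

section \<open>Clearing denominators, and equality of localized ideals\<close>

text \<open>The product of the individual multipliers works for all indices, since
  \<open>P i\<close> survives multiplication by elements of \<open>S\<close>. It is applied to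
  multipliers of generators, to denominators and to equality of vectors.\<close>

lemma ex_common_multiple:
  assumes "finite A" "\<And>i. i \<in> A \<Longrightarrow> \<exists>u\<in>S. P i u"
    and mult: "\<And>i u t. \<lbrakk>i \<in> A; P i u; u \<in> S; t \<in> S\<rbrakk> \<Longrightarrow> P i (u \<otimes> t)"
  shows "\<exists>u\<in>S. \<forall>i\<in>A. P i u"
  using assms
proof (induction A rule: finite_induct)
  case empty
  then show ?case using mult_subset(2) by blast
next
  case (insert j A)
  obtain u where u: "u \<in> S" "\<And>i. i \<in> A \<Longrightarrow> P i u"
    using insert.IH insert.prems by (metis insertI2)
  obtain t where t: "t \<in> S" "P j t" using insert.prems(1) by blast
  \<comment> \<open>Stability is assumed only for new factors on the right, so the multiplier of
    \<open>j\<close> has to be commuted to match that of \<open>A\<close>.\<close>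
  have "P j (t \<otimes> u)" by (rule insert.prems(2)) (use u t in simp_all)
  then have "P j (u \<otimes> t)" using m_comm[of t u] u t by simp
  moreover have "P i (u \<otimes> t)" if "i \<in> A" for i
    by (rule insert.prems(2)) (use u t that in simp_all)
  ultimately show ?case using mult_subset(4)[OF u(1) t(1)] by blast
qed

text \<open>This is the colon ideal (J : a). It lets a condition a x \<in> J that holds on
  generators spread to the ideal they generate.\<close>

lemma ideal_colon:
  assumes J: "ideal J R" and a: "a \<in> carrier R"
  shows "ideal {x \<in> carrier R. a \<otimes> x \<in> J} R"
proof -
  interpret J: ideal J R by fact
  have "submodule {x \<in> carrier R. a \<otimes> x \<in> J} R (self_module R)"
  proof (rule module.submodule_add_smultI[OF module_self_module])
    fix b x assume "b \<in> carrier R" "x \<in> {x \<in> carrier R. a \<otimes> x \<in> J}"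
    moreover from this have "a \<otimes> (b \<otimes> x) = b \<otimes> (a \<otimes> x)" using a by (simp add: m_lcomm)
    ultimately show "b \<odot>\<^bsub>self_module R\<^esub> x \<in> {x \<in> carrier R. a \<otimes> x \<in> J}"
      by (simp add: self_module_def J.I_l_closed)
  qed (use a in \<open>auto simp: self_module_def r_distr\<close>)
  then show ?thesis by (simp add: submodule_self_module_iff)
qed

text \<open>If a/s = b/t with b \<in> J, then u a t = u b s for some u \<in> S, so (u t) a lies in
  J. Conversely a/s = (u a)/(u s).\<close>

lemma loc_frac_in_localized_ideal_iff:
  assumes J: "ideal J R" and c: "a \<in> carrier R" "s \<in> S"
  shows "loc_frac R S a s \<in> localized_ideal R S J \<longleftrightarrow> (\<exists>u\<in>S. u \<otimes> a \<in> J)"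
proof
  assume "loc_frac R S a s \<in> localized_ideal R S J"
  then obtain b t where b: "b \<in> J" "t \<in> S" "loc_frac R S a s = loc_frac R S b t"
    by (auto simp: localized_ideal_def)
  then have bc: "b \<in> carrier R" by (simp add: ideal.Icarr[OF J])
  obtain u where u: "u \<in> S" "u \<otimes> (a \<otimes> t) = u \<otimes> (b \<otimes> s)"
    using b bc c by (auto simp: loc_frac_eq_iff)
  have "u \<otimes> t \<otimes> a = u \<otimes> s \<otimes> b" using u b bc c by (simp add: m_ac)
  also have "\<dots> \<in> J" using u b c by (simp add: ideal.I_l_closed[OF J])
  finally show "\<exists>u\<in>S. u \<otimes> a \<in> J" using u b by (intro bexI[of _ "u \<otimes> t"]) auto
next
  assume "\<exists>u\<in>S. u \<otimes> a \<in> J"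
  then obtain u where u: "u \<in> S" "u \<otimes> a \<in> J" by blast
  have "loc_frac R S a s = loc_frac R S (u \<otimes> a) (u \<otimes> s)"
    by (rule loc_frac_eqI) (use u c in \<open>auto simp: m_ac\<close>)
  then show "loc_frac R S a s \<in> localized_ideal R S J"
    using u c by (auto simp: localized_ideal_def)
qed

text \<open>From right to left, s serves as multiplier for every numerator. From left to right, each
  generator x has x/1 \<in> J_S, so some multiple of x lies in J; a common multiplier s for the
  finitely many generators puts them, hence all of I, into the colon ideal (J : s).\<close>

lemma localized_ideal_eq_iff:
  assumes I: "fin_gen_ideal I R" and J: "ideal J R" "J \<subseteq> I"
  shows "localized_ideal R S I = localized_ideal R S J \<longleftrightarrow> (\<exists>s\<in>S. \<forall>x\<in>I. s \<otimes> x \<in> J)"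
proof
  assume s: "\<exists>s\<in>S. \<forall>x\<in>I. s \<otimes> x \<in> J"
  have "loc_frac R S a t \<in> localized_ideal R S J" if "a \<in> I" "t \<in> S" for a t
    using s that ideal.Icarr[OF fin_gen_ideal_imp_ideal[OF I] that(1)]
      loc_frac_in_localized_ideal_iff[OF J(1)] by blast
  then have "localized_ideal R S I \<subseteq> localized_ideal R S J"
    unfolding localized_ideal_def[of R S I] by blast
  then show "localized_ideal R S I = localized_ideal R S J"
    using J(2) unfolding localized_ideal_def by blast
next
  assume eq: "localized_ideal R S I = localized_ideal R S J"
  obtain A where A: "finite A" "A \<subseteq> carrier R" "I = genideal R A"
    using I unfolding fin_gen_ideal_def by auto
  have "\<exists>s\<in>S. \<forall>x\<in>A. s \<otimes> x \<in> J"
  proof (rule ex_common_multiple[OF A(1)])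
    fix x assume x: "x \<in> A"
    then have "loc_frac R S x \<one> \<in> localized_ideal R S I"
      using genideal_self[OF A(2)] mult_subset(2) unfolding A(3) localized_ideal_def by blast
    then show "\<exists>s\<in>S. s \<otimes> x \<in> J"
      using x A(2) by (simp add: eq subset_eq loc_frac_in_localized_ideal_iff[OF J(1)])
  next
    fix x u t assume "x \<in> A" "u \<otimes> x \<in> J" "u \<in> S" "t \<in> S"
    moreover from this have "u \<otimes> t \<otimes> x = t \<otimes> (u \<otimes> x)" using A(2) by (auto simp: m_ac)
    ultimately show "u \<otimes> t \<otimes> x \<in> J" by (simp add: ideal.I_l_closed[OF J(1)])
  qed
  then obtain s where s: "s \<in> S" "\<forall>x\<in>A. s \<otimes> x \<in> J" by blast
  have "I \<subseteq> {x \<in> carrier R. s \<otimes> x \<in> J}"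
    unfolding A(3) by (rule genideal_minimal[OF ideal_colon]) (use A s J in auto)
  then show "\<exists>s\<in>S. \<forall>x\<in>I. s \<otimes> x \<in> J" using s by blast
qed

section \<open>Common denominators and finitely generated ideals of the localization\<close>

text \<open>Being a fraction over u is preserved when u is enlarged to u t, because a/u = (a t)/(u
  t); so finitely many denominators can be merged.\<close>

lemma ex_common_denominator:
  assumes "finite A" "f \<in> A \<rightarrow> carrier (localization R S)"
  obtains t c where "t \<in> S" "c \<in> A \<rightarrow>\<^sub>E carrier R" "\<And>x. x \<in> A \<Longrightarrow> f x = loc_frac R S (c x) t"
proof -
  have "\<exists>t\<in>S. \<forall>x\<in>A. \<exists>a\<in>carrier R. f x = loc_frac R S a t"
  proof (rule ex_common_multiple[OF assms(1)])
    fix x assume "x \<in> A"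
    then have "f x \<in> carrier (localization R S)" by (rule funcset_mem[OF assms(2)])
    then show "\<exists>t\<in>S. \<exists>a\<in>carrier R. f x = loc_frac R S a t"
      by (elim carrier_localizationE) (intro bexI)
  next
    fix x u t assume ex: "\<exists>a\<in>carrier R. f x = loc_frac R S a u" and ut: "u \<in> S" "t \<in> S"
    obtain a where a: "a \<in> carrier R" "f x = loc_frac R S a u" using ex by (rule bexE)
    have "f x = loc_frac R S (a \<otimes> t) (u \<otimes> t)"
      unfolding a(2) by (rule loc_frac_eqI) (use a(1) ut in \<open>simp_all add: m_ac\<close>)
    then show "\<exists>a\<in>carrier R. f x = loc_frac R S a (u \<otimes> t)"
      by (rule bexI) (use a(1) ut in simp)
  qed
  then obtain t where t: "t \<in> S" "\<forall>x\<in>A. \<exists>a\<in>carrier R. f x = loc_frac R S a t"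
    by (rule bexE)
  obtain c where c: "\<forall>x\<in>A. c x \<in> carrier R \<and> f x = loc_frac R S (c x) t"
    using bchoice[OF t(2)[unfolded Bex_def]] by (rule exE)
  show ?thesis
  proof (rule that[OF t(1)])
    \<comment> \<open>The chosen numerators are made extensional, so that for \<open>A\<close> =
      \<open>{..<n}\<close> they form an element of \<open>free_module R n\<close>.\<close>
    show "restrict c A \<in> A \<rightarrow>\<^sub>E carrier R" using c by simp
    show "f x = loc_frac R S (restrict c A x) t" if "x \<in> A" for x using c that by simp
  qed
qed

text \<open>The denominator t is harmless because it is a unit in the localization. One inclusion is
  minimality of the generated ideal; the other contracts that ideal to \<open>R\<close> and finds
  \<open>A\<close> in the contraction.\<close>

lemma localized_ideal_genideal:
  assumes A: "A \<subseteq> carrier R" and t: "t \<in> S"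
  shows "localized_ideal R S (genideal R A) =
    genideal (localization R S) ((\<lambda>a. loc_frac R S a t) ` A)"
    (is "_ = genideal ?L ?B")
proof
  interpret L: cring ?L by (rule cring_localization)
  have B: "?B \<subseteq> carrier ?L" using A t by (auto simp: loc_frac_in_carrier)
  interpret K: ideal "genideal ?L ?B" ?L by (rule L.genideal_ideal[OF B])
  \<comment> \<open>The contraction of the generated ideal along a \<mapsto> a/1.\<close>
  let ?P = "{a \<in> carrier R. loc_frac R S a \<one> \<in> genideal ?L ?B}"
  have mult: "loc_frac R S (x \<otimes> a) (s \<otimes> r) \<in> genideal ?L ?B"
    if "loc_frac R S a r \<in> genideal ?L ?B" "a \<in> carrier R" "x \<in> carrier R" "s \<in> S" "r \<in> S" for a x s r
    using K.I_l_closed[OF that(1) loc_frac_in_carrier[of x s]] that by (simp add: mult_loc_frac)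
  have "submodule ?P R (self_module R)"
  proof (rule module.submodule_add_smultI[OF module_self_module])
    show "\<zero>\<^bsub>self_module R\<^esub> \<in> ?P"
      using K.zero_closed by (simp add: self_module_def one_zero_localization)
    fix a b assume "a \<in> ?P" "b \<in> ?P"
    then show "a \<oplus>\<^bsub>self_module R\<^esub> b \<in> ?P"
      using K.a_closed[of "loc_frac R S a \<one>" "loc_frac R S b \<one>"]
      by (simp add: self_module_def add_loc_frac)
  next
    fix a x assume "a \<in> carrier R" "x \<in> ?P"
    then show "a \<odot>\<^bsub>self_module R\<^esub> x \<in> ?P"
      using mult[of x \<one> a \<one>] by (simp add: self_module_def)
  qed (auto simp: self_module_def)
  then have P: "ideal ?P R" by (simp add: submodule_self_module_iff)
  have "A \<subseteq> ?P"
  proof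
    fix a assume a: "a \<in> A"
    then have "loc_frac R S a t \<in> genideal ?L ?B" using L.genideal_self[OF B] by auto
    \<comment> \<open>The generator a/t is multiplied by t/1 to recover a/1.\<close>
    then have "loc_frac R S (t \<otimes> a) (\<one> \<otimes> t) \<in> genideal ?L ?B"
      using a A t by (intro mult) auto
    moreover have "loc_frac R S (t \<otimes> a) (\<one> \<otimes> t) = loc_frac R S a \<one>"
      by (rule loc_frac_eqI) (use a A t in \<open>auto simp: m_ac\<close>)
    ultimately show "a \<in> ?P" using a A by auto
  qed
  then have sub: "genideal R A \<subseteq> ?P" by (rule genideal_minimal[OF P])
  show "localized_ideal R S (genideal R A) \<subseteq> genideal ?L ?B"
  proof
    fix x assume "x \<in> localized_ideal R S (genideal R A)"
    then obtain a s where a: "a \<in> ?P" "s \<in> S" "x = loc_frac R S a s"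
      using sub by (auto simp: localized_ideal_def)
    \<comment> \<open>Here a/s = (1/s)(a/1).\<close>
    then show "x \<in> genideal ?L ?B" using mult[of a \<one> \<one> s] by simp
  qed
  show "genideal ?L ?B \<subseteq> localized_ideal R S (genideal R A)"
    by (rule L.genideal_minimal[OF ideal_localized_ideal[OF genideal_ideal[OF A]]])
      (use genideal_self[OF A] t in \<open>auto simp: localized_ideal_def\<close>)
qed

lemma fin_gen_ideal_localizationE:
  assumes "fin_gen_ideal K (localization R S)"
  obtains I where "fin_gen_ideal I R" "K = localized_ideal R S I"
proof -
  obtain B where B: "finite B" "B \<subseteq> carrier (localization R S)" "K = genideal (localization R S) B"
    using assms unfolding fin_gen_ideal_def by auto
  \<comment> \<open>The identity function on \<open>B\<close> is the family of fractions, so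
    \<open>c\<close> assigns to each generator its numerator over \<open>t\<close>; these numerators
    will generate \<open>I\<close>.\<close>
  obtain t c where t: "t \<in> S" "c \<in> B \<rightarrow>\<^sub>E carrier R" "\<And>x. x \<in> B \<Longrightarrow> x = loc_frac R S (c x) t"
    using ex_common_denominator[OF B(1), of "\<lambda>x. x"] B(2) by blast
  have c: "c ` B \<subseteq> carrier R" using t(2) by auto
  have "(\<lambda>a. loc_frac R S a t) ` c ` B = (\<lambda>x. x) ` B"
    unfolding image_image by (rule image_cong[OF refl]) (rule t(3)[symmetric])
  then have "K = localized_ideal R S (genideal R (c ` B))"
    unfolding localized_ideal_genideal[OF c t(1)] B(3) by simp
  moreover have "fin_gen_ideal (genideal R (c ` B)) R"
    unfolding fin_gen_ideal_def using B(1) c by (intro exI[of _ "c ` B"]) simp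
  ultimately show ?thesis using that by blast
qed

section \<open>Identifying the free module over the localization with the localized free
  module\<close>

text \<open>The vector c/s with one denominator for all coordinates. The restriction to
  \<open>{..<n}\<close> makes it extensional, as the carrier of \<open>free_module\<close>
  requires.\<close>

definition frac_vec :: "nat \<Rightarrow> (nat \<Rightarrow> 'a) \<Rightarrow> 'a \<Rightarrow> nat \<Rightarrow> ('a \<times> 'a) set"
  where "frac_vec n c s = (\<lambda>i\<in>{..<n}. loc_frac R S (c i) s)"

lemma frac_vec_in_carrier:
  "\<lbrakk>c \<in> carrier (free_module R n); s \<in> S\<rbrakk> \<Longrightarrow>
    frac_vec n c s \<in> carrier (free_module (localization R S) n)"
  unfolding frac_vec_def free_module_simps cring.free_module_simps[OF cring_localization]
  by (intro restrict_PiE_iff[THEN iffD2] ballI loc_frac_in_carrier) auto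

lemma free_localizationE:
  assumes "v \<in> carrier (free_module (localization R S) n)"
  obtains c s where "c \<in> carrier (free_module R n)" "s \<in> S" "v = frac_vec n c s"
proof -
  have v: "v \<in> {..<n} \<rightarrow>\<^sub>E carrier (localization R S)" using assms by (simp add: free_module_def)
  then have "v \<in> {..<n} \<rightarrow> carrier (localization R S)" by auto
  then obtain t c where t: "t \<in> S" "c \<in> {..<n} \<rightarrow>\<^sub>E carrier R"
    "\<And>i. i \<in> {..<n} \<Longrightarrow> v i = loc_frac R S (c i) t"
    using ex_common_denominator[OF finite_lessThan, of v n] by blast
  have "v = frac_vec n c t"
    using v t by (auto simp: frac_vec_def PiE_iff extensional_def fun_eq_iff)
  with t show ?thesis by (intro that[of c t]) (simp_all add: free_module_def)
qed

text \<open>Each coordinate equation c i / s = d i / t has its own multiplier; as there are only n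
  coordinates, one u serves them all. The conclusion is an equation in R^n, to which a linear map
  can be applied.\<close>

lemma frac_vec_eqD:
  assumes "frac_vec n c s = frac_vec n d t"
    and c: "c \<in> carrier (free_module R n)" "s \<in> S" "d \<in> carrier (free_module R n)" "t \<in> S"
  obtains u where "u \<in> S"
    "(u \<otimes> t) \<odot>\<^bsub>free_module R n\<^esub> c = (u \<otimes> s) \<odot>\<^bsub>free_module R n\<^esub> d"
proof -
  have car: "c i \<in> carrier R" "d i \<in> carrier R" if "i \<in> {..<n}" for i
    using that c by (auto simp: free_module_simps)
  have "\<exists>u\<in>S. \<forall>i\<in>{..<n}. u \<otimes> (c i \<otimes> t) = u \<otimes> (d i \<otimes> s)"
  proof (rule ex_common_multiple)
    fix i assume i: "i \<in> {..<n}"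
    then have "loc_frac R S (c i) s = loc_frac R S (d i) t"
      using fun_cong[OF assms(1), of i] by (simp add: frac_vec_def)
    then show "\<exists>u\<in>S. u \<otimes> (c i \<otimes> t) = u \<otimes> (d i \<otimes> s)"
      using i car c by (simp add: loc_frac_eq_iff)
  next
    fix i u v assume "i \<in> {..<n}" "u \<otimes> (c i \<otimes> t) = u \<otimes> (d i \<otimes> s)" "u \<in> S" "v \<in> S"
    then show "u \<otimes> v \<otimes> (c i \<otimes> t) = u \<otimes> v \<otimes> (d i \<otimes> s)"
      using car c by (simp add: m_comm[of u v] m_assoc)
  qed simp
  then obtain u where u: "u \<in> S" "\<And>i. i \<in> {..<n} \<Longrightarrow> u \<otimes> (c i \<otimes> t) = u \<otimes> (d i \<otimes> s)" by blast
  have "u \<otimes> t \<otimes> c i = u \<otimes> s \<otimes> d i" if "i \<in> {..<n}" for i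
    using u(2)[OF that] car[OF that] u(1) c(2,4) by (simp add: m_ac)
  then show ?thesis
    using u(1) by (intro that[of u]) (auto simp: free_module_simps intro!: restrict_ext)
qed

lemma add_frac_vec:
  assumes "c \<in> carrier (free_module R n)" "s \<in> S" "d \<in> carrier (free_module R n)" "t \<in> S"
  shows "frac_vec n c s \<oplus>\<^bsub>free_module (localization R S) n\<^esub> frac_vec n d t =
    frac_vec n (t \<odot>\<^bsub>free_module R n\<^esub> c \<oplus>\<^bsub>free_module R n\<^esub> s \<odot>\<^bsub>free_module R n\<^esub> d) (s \<otimes> t)"
  using assms
  by (auto simp: frac_vec_def free_module_simps cring.free_module_simps[OF cring_localization]
      add_loc_frac PiE_iff m_comm intro!: restrict_ext)

lemma smult_frac_vec:
  assumes "a \<in> carrier R" "s \<in> S" "c \<in> carrier (free_module R n)" "t \<in> S"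
  shows "loc_frac R S a s \<odot>\<^bsub>free_module (localization R S) n\<^esub> frac_vec n c t =
    frac_vec n (a \<odot>\<^bsub>free_module R n\<^esub> c) (s \<otimes> t)"
  using assms
  by (auto simp: frac_vec_def free_module_simps cring.free_module_simps[OF cring_localization]
      mult_loc_frac PiE_iff intro!: restrict_ext)

lemma zero_frac_vec:
  "\<zero>\<^bsub>free_module (localization R S) n\<^esub> = frac_vec n \<zero>\<^bsub>free_module R n\<^esub> \<one>"
  by (simp add: frac_vec_def free_module_simps cring.free_module_simps[OF cring_localization]
      one_zero_localization cong: restrict_cong)

lemma frac_vec_cancel:
  assumes "c \<in> carrier (free_module R n)" "s \<in> S" "u \<in> S"
  shows "frac_vec n (u \<odot>\<^bsub>free_module R n\<^esub> c) (u \<otimes> s) = frac_vec n c s"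
  unfolding frac_vec_def free_module_simps
proof (rule restrict_ext)
  fix i assume i: "i \<in> {..<n}"
  then have "c i \<in> carrier R" using assms(1) by (auto simp: free_module_simps)
  with i show "loc_frac R S ((\<lambda>i\<in>{..<n}. u \<otimes> c i) i) (u \<otimes> s) = loc_frac R S (c i) s"
    using assms(2,3) by (intro loc_frac_eqI) (simp_all add: m_ac)
qed

section \<open>Localizing a finite presentation\<close>

text \<open>The value f c / s depends only on the vector c/s: if c/s = d/t, then (u t) c = (u s) d
  for some u \<in> S, and applying f gives u t f c = u s f d.\<close>

lemma localized_lin_map:
  assumes J: "ideal J R" and f: "f \<in> lin_maps R (free_module R n) (ideal_module R J)"
  obtains g where
    "g \<in> lin_maps (localization R S) (free_module (localization R S) n)
       (ideal_module (localization R S) (localized_ideal R S J))"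
    "\<And>c s. \<lbrakk>c \<in> carrier (free_module R n); s \<in> S\<rbrakk> \<Longrightarrow> g (frac_vec n c s) = loc_frac R S (f c) s"
proof -
  let ?F = "free_module R n" and ?L = "localization R S"
  interpret F: module R ?F by (rule module_free_module)
  note fD = lin_mapsD[OF f, simplified]
  have fcar: "f c \<in> carrier R" if "c \<in> carrier ?F" for c
    using fD(1)[OF that] ideal.Icarr[OF J] by auto
  have wd: "loc_frac R S (f c) s = loc_frac R S (f d) t"
    if eq: "frac_vec n c s = frac_vec n d t"
      and c: "c \<in> carrier ?F" "s \<in> S" "d \<in> carrier ?F" "t \<in> S" for c s d t
  proof -
    obtain u where u: "u \<in> S" "(u \<otimes> t) \<odot>\<^bsub>?F\<^esub> c = (u \<otimes> s) \<odot>\<^bsub>?F\<^esub> d"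
      using frac_vec_eqD[OF eq c] by blast
    have "u \<otimes> t \<otimes> f c = f ((u \<otimes> t) \<odot>\<^bsub>?F\<^esub> c)" using u(1) c by (simp add: fD(3))
    also have "\<dots> = u \<otimes> s \<otimes> f d" unfolding u(2) using u(1) c by (simp add: fD(3))
    finally have "u \<otimes> (f c \<otimes> t) = u \<otimes> (f d \<otimes> s)"
      using u(1) c fcar by (simp add: m_ac)
    then show ?thesis using u(1) c fcar by (auto simp: loc_frac_eq_iff)
  qed
  \<comment> \<open>The value y is required to suit every representation of v at once, so that
    choosing y for each v yields a function agreeing with all of them.\<close>
  have "\<forall>v\<in>carrier (free_module ?L n). \<exists>y. \<forall>c\<in>carrier ?F. \<forall>s\<in>S.
      v = frac_vec n c s \<longrightarrow> y = loc_frac R S (f c) s"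
  proof
    fix v assume "v \<in> carrier (free_module ?L n)"
    then obtain c s where "c \<in> carrier ?F" "s \<in> S" "v = frac_vec n c s"
      by (rule free_localizationE)
    then show "\<exists>y. \<forall>c\<in>carrier ?F. \<forall>s\<in>S. v = frac_vec n c s \<longrightarrow> y = loc_frac R S (f c) s"
      using wd by (intro exI[of _ "loc_frac R S (f c) s"]) blast
  qed
  then obtain g where "\<forall>v\<in>carrier (free_module ?L n). \<forall>c\<in>carrier ?F. \<forall>s\<in>S.
      v = frac_vec n c s \<longrightarrow> g v = loc_frac R S (f c) s"
    by metis
  then have g: "g (frac_vec n c s) = loc_frac R S (f c) s" if "c \<in> carrier ?F" "s \<in> S" for c s
    using frac_vec_in_carrier[OF that] that by blast
  have "g \<in> lin_maps ?L (free_module ?L n) (ideal_module ?L (localized_ideal R S J))"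
    unfolding lin_maps_def
  proof (intro CollectI conjI ballI funcsetI)
    fix v assume "v \<in> carrier (free_module ?L n)"
    then obtain c s where "c \<in> carrier ?F" "s \<in> S" "v = frac_vec n c s"
      by (rule free_localizationE)
    then show "g v \<in> carrier (ideal_module ?L (localized_ideal R S J))"
      using fD(1) by (auto simp: g localized_ideal_def)
  next
    fix v w assume v: "v \<in> carrier (free_module ?L n)" "w \<in> carrier (free_module ?L n)"
    obtain c s where c: "c \<in> carrier ?F" "s \<in> S" "v = frac_vec n c s"
      using v(1) by (rule free_localizationE)
    obtain d t where d: "d \<in> carrier ?F" "t \<in> S" "w = frac_vec n d t"
      using v(2) by (rule free_localizationE)
    show "g (v \<oplus>\<^bsub>free_module ?L n\<^esub> w) =
        g v \<oplus>\<^bsub>ideal_module ?L (localized_ideal R S J)\<^esub> g w"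
      using c d by (simp add: add_frac_vec g fD fcar add_loc_frac m_comm)
  next
    fix a v assume a: "a \<in> carrier ?L" and v: "v \<in> carrier (free_module ?L n)"
    obtain c s where c: "c \<in> carrier ?F" "s \<in> S" "v = frac_vec n c s"
      using v by (rule free_localizationE)
    obtain b t where b: "a = loc_frac R S b t" "b \<in> carrier R" "t \<in> S"
      using a by (rule carrier_localizationE)
    show "g (a \<odot>\<^bsub>free_module ?L n\<^esub> v) =
        a \<odot>\<^bsub>ideal_module ?L (localized_ideal R S J)\<^esub> g v"
      using b c by (simp add: smult_frac_vec g fD fcar mult_loc_frac)
  qed
  with g show ?thesis using that by blast
qed

lemma fin_pres_localized_ideal:
  assumes J: "ideal J R" and fp: "fin_pres_module R (ideal_module R J)"
  shows "fin_pres_module (localization R S)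
    (ideal_module (localization R S) (localized_ideal R S J))"
proof -
  let ?L = "localization R S" and ?JS = "localized_ideal R S J"
  interpret L: cring ?L by (rule cring_localization)
  obtain n f where f: "f \<in> lin_maps R (free_module R n) (ideal_module R J)"
    "f ` carrier (free_module R n) = J"
    "fin_gen_module R ((free_module R n)\<lparr>carrier := a_kernel (free_module R n) (ideal_module R J) f\<rparr>)"
    using fp unfolding fin_pres_module_def by auto
  define F FL where "F = free_module R n" and "FL = free_module ?L n"
  define K where "K = a_kernel F (ideal_module R J) f"
  interpret F: module R F unfolding F_def by (rule module_free_module)
  interpret FL: module ?L FL unfolding FL_def by (rule L.module_free_module)
  note fD = lin_mapsD[OF f(1), folded F_def, simplified]
  have fcar: "f c \<in> carrier R" if "c \<in> carrier F" for c
    using fD(1)[OF that] ideal.Icarr[OF J] by auto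
  have subK: "submodule K R F"
    unfolding K_def F_def
    by (rule submodule_a_kernel[OF module_free_module module_ideal_module[OF J] f(1)])
  have K_iff: "c \<in> K \<longleftrightarrow> c \<in> carrier F \<and> f c = \<zero>" for c
    by (simp add: K_def a_kernel_def')
  obtain B where B: "finite B" "B \<subseteq> K"
    "\<And>N. \<lbrakk>submodule N R F; B \<subseteq> N; N \<subseteq> K\<rbrakk> \<Longrightarrow> N = K"
    using f(3) unfolding F_def[symmetric] K_def[symmetric] F.fin_gen_submodule_iff[OF subK] by blast
  obtain g where g: "g \<in> lin_maps ?L FL (ideal_module ?L ?JS)"
    "\<And>c s. \<lbrakk>c \<in> carrier F; s \<in> S\<rbrakk> \<Longrightarrow> g (frac_vec n c s) = loc_frac R S (f c) s"
    using localized_lin_map[OF J f(1)] unfolding F_def FL_def by blast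
  define KL where "KL = a_kernel FL (ideal_module ?L ?JS) g"
  have subKL: "submodule KL ?L FL"
    unfolding KL_def
    by (rule submodule_a_kernel[OF FL.module_axioms _ g(1)])
      (rule L.module_ideal_module[OF ideal_localized_ideal[OF J]])
  have KL_iff: "v \<in> KL \<longleftrightarrow> v \<in> carrier FL \<and> g v = loc_frac R S \<zero> \<one>" for v
    by (simp add: KL_def a_kernel_def' one_zero_localization)
  note vec = frac_vec_in_carrier[of _ n, folded F_def FL_def]
    add_frac_vec[of _ n, folded F_def FL_def] smult_frac_vec[of _ _ _ n, folded F_def FL_def]
    zero_frac_vec[of n, folded F_def FL_def] frac_vec_cancel[of _ n, folded F_def]
  \<comment> \<open>For a = f c, the fraction a/s is the image of c/s.\<close>
  have surj: "g ` carrier FL = ?JS"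
  proof
    show "g ` carrier FL \<subseteq> ?JS" using lin_mapsD(1)[OF g(1)] by auto
    show "?JS \<subseteq> g ` carrier FL"
    proof
      fix y assume "y \<in> ?JS"
      then obtain a s where a: "a \<in> J" "s \<in> S" "y = loc_frac R S a s"
        by (auto simp: localized_ideal_def)
      then obtain c where "c \<in> carrier F" "a = f c" using f(2) unfolding F_def by blast
      then show "y \<in> g ` carrier FL"
        using a g(2) vec(1) by (intro image_eqI[of _ _ "frac_vec n c s"]) auto
    qed
  qed
  have in_KL: "frac_vec n c \<one> \<in> KL" if "c \<in> K" for c
    using that by (simp add: KL_iff K_iff vec g(2))
  \<comment> \<open>Generation of the localized kernel, in minimality form: \<open>N\<close> is
    pulled back to \<open>K\<close>, where the minimality of \<open>K\<close> over \<open>B\<close>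
    applies.\<close>
  have "N = KL" if N: "submodule N ?L FL" "(\<lambda>b. frac_vec n b \<one>) ` B \<subseteq> N" "N \<subseteq> KL" for N
  proof
    interpret N: submodule N ?L FL by fact
    note Nadd = FL.submoduleE(5)[OF N(1)]
    let ?P = "{c \<in> K. frac_vec n c \<one> \<in> N}"
    have "submodule ?P R F"
    proof (rule F.submodule_add_smultI)
      show "?P \<subseteq> carrier F" by (auto simp: K_iff)
      show "\<zero>\<^bsub>F\<^esub> \<in> ?P"
        using subgroup.one_closed[OF submodule.axioms(1)[OF N(1)]]
          subgroup.one_closed[OF submodule.axioms(1)[OF subK]] by (simp add: vec)
    next
      fix c d assume cd: "c \<in> ?P" "d \<in> ?P"
      then have "frac_vec n c \<one> \<oplus>\<^bsub>FL\<^esub> frac_vec n d \<one> \<in> N" by (intro Nadd) auto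
      then show "c \<oplus>\<^bsub>F\<^esub> d \<in> ?P"
        using cd F.submoduleE(5)[OF subK, of c d] by (simp add: vec K_iff)
    next
      fix a c assume ac: "a \<in> carrier R" "c \<in> ?P"
      then have "loc_frac R S a \<one> \<odot>\<^bsub>FL\<^esub> frac_vec n c \<one> \<in> N"
        by (intro N.smult_closed) (auto simp: loc_frac_in_carrier)
      then show "a \<odot>\<^bsub>F\<^esub> c \<in> ?P"
        using ac F.submoduleE(4)[OF subK, of a c] by (simp add: vec K_iff)
    qed
    \<comment> \<open>The pullback contains \<open>B\<close>, so it is all of \<open>K\<close>:
      every kernel vector c of f has c/1 \<in> N.\<close>
    then have P: "?P = K" by (rule B(3)) (use B(2) N(2) in auto)
    show "KL \<subseteq> N"
    proof
      fix v assume v: "v \<in> KL"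
      then have "v \<in> carrier FL" by (simp add: KL_iff)
      then obtain c s where c: "c \<in> carrier F" "s \<in> S" "v = frac_vec n c s"
        unfolding F_def FL_def by (rule free_localizationE)
      then have "loc_frac R S (f c) s = loc_frac R S \<zero> \<one>" using v g(2) by (simp add: KL_iff)
      \<comment> \<open>Vanishing of f c / s only says that some u \<in> S kills f c; it is u c, not
        c, that lies in \<open>K\<close>.\<close>
      then obtain u where u: "u \<in> S" "u \<otimes> f c = \<zero>"
        using c fcar by (auto simp: loc_frac_eq_iff)
      then have "u \<odot>\<^bsub>F\<^esub> c \<in> K" using c by (simp add: K_iff fD)
      then have "frac_vec n (u \<odot>\<^bsub>F\<^esub> c) \<one> \<in> N" using P by blast
      \<comment> \<open>The scalar 1/(u s) undoes both u and the lost denominator: (1/(u s)) (u c /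
        1) = c/s.\<close>
      then have "loc_frac R S \<one> (u \<otimes> s) \<odot>\<^bsub>FL\<^esub> frac_vec n (u \<odot>\<^bsub>F\<^esub> c) \<one> \<in> N"
        using u c by (intro N.smult_closed) (auto simp: loc_frac_in_carrier)
      then show "v \<in> N" using u c by (simp add: vec)
    qed
  qed fact
  then have "fin_gen_module ?L (FL\<lparr>carrier := KL\<rparr>)"
    unfolding FL.fin_gen_submodule_iff[OF subKL] using B(1,2) in_KL
    by (intro exI[of _ "(\<lambda>b. frac_vec n b \<one>) ` B"]) auto
  then show ?thesis
    unfolding fin_pres_module_def using g(1) surj
    by (intro exI[of _ n] bexI[of _ g]) (auto simp: FL_def KL_def)
qed

end

section \<open>The equivalences and the coherence of the localization\<close>

theorem theorem4p7:
  fixes R :: "('a, 'b) ring_scheme" and S :: "'a set"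
  assumes "cring R" and "submonoid S R"
  shows
    "(c_S_coherent S R \<longleftrightarrow>
       (\<forall>I. fin_gen_ideal I R \<longrightarrow> c_S_fin_pres S R (ideal_module R I))) \<and>
     ((\<forall>I. fin_gen_ideal I R \<longrightarrow> c_S_fin_pres S R (ideal_module R I)) \<longleftrightarrow>
       (\<forall>I. fin_gen_ideal I R \<longrightarrow>
          (\<exists>J. ideal J R \<and> J \<subseteq> I \<and> fin_pres_module R (ideal_module R J) \<and>
               localized_ideal R S I = localized_ideal R S J))) \<and>
     ((\<forall>I. fin_gen_ideal I R \<longrightarrow>
          (\<exists>J. ideal J R \<and> J \<subseteq> I \<and> fin_pres_module R (ideal_module R J) \<and>
               localized_ideal R S I = localized_ideal R S J)) \<longrightarrow>
       coherent_ring (localization R S))"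
proof -
  interpret mult_subset_cring R S
    using assms by (rule mult_subset_cring.intro)
  \<comment> \<open>The second and third assertions agree ideal by ideal, with the same
    \<open>J\<close>, since s I \<subseteq> J for some s \<in> S means I_S = J_S.\<close>
  have "c_S_fin_pres S R (ideal_module R I) \<longleftrightarrow>
      (\<exists>J. ideal J R \<and> J \<subseteq> I \<and> fin_pres_module R (ideal_module R J) \<and>
        localized_ideal R S I = localized_ideal R S J)" if "fin_gen_ideal I R" for I
    unfolding c_S_fin_pres_ideal_iff[OF fin_gen_ideal_imp_ideal[OF that]]
    using localized_ideal_eq_iff[OF that] by blast
  moreover have "coherent_ring (localization R S)"
    if H: "\<forall>I. fin_gen_ideal I R \<longrightarrow>
      (\<exists>J. ideal J R \<and> J \<subseteq> I \<and> fin_pres_module R (ideal_module R J) \<and>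
        localized_ideal R S I = localized_ideal R S J)"
  proof (intro coherent_ring.intro coherent_ring_axioms.intro cring_localization)
    fix K assume "fin_gen_ideal K (localization R S)"
    then obtain I where I: "fin_gen_ideal I R" "K = localized_ideal R S I"
      by (rule fin_gen_ideal_localizationE)
    \<comment> \<open>\<open>K\<close> is rewritten as the localization of \<open>J\<close> instead
      of \<open>I\<close>, because it is \<open>J\<close> that comes with a finite presentation to
      localize.\<close>
    then obtain J where "ideal J R" "fin_pres_module R (ideal_module R J)"
      "K = localized_ideal R S J"
      using H by metis
    then show "fin_pres_module (localization R S) (ideal_module (localization R S) K)"
      using fin_pres_localized_ideal by blast
  qed
  ultimately show ?thesis
    using c_S_coherent_iff by blast
qed

end
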